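(* Let $G$ be a finite group and $S\subseteq G$ a nonempty symmetric generating set. The Laplacian $\mathcal{L}:L^2(G)\to L^2(G)$ is block diagonal with one block for every irreducible representation $\sigma\in\widehat{G}$, i.e. it preserves each subspace $\mathcal{A}_\sigma$. Moreover, on the block $\mathcal{A}_\sigma$, $\mathcal{L}$ acts as $I_{d_\sigma}\otimes(I_{d_\sigma}-M_\sigma)$, where $M_\sigma:=\frac{1}{|S|}\sum_{s\in S}\sigma(s)$.
   Context: $L^2(G)$ is the space of functions $f:G\to\mathbb{C}$ with inner product $\langle f,h\rangle=\frac{1}{|G|}\sum_{g\in G}\overline{f(g)}h(g)$. A subset $S$ is symmetric if $s^{-1}\in S$ for all $s\in S$. The averaging operator is $(Af)(g)=\frac{1}{|S|}\sum_{s\in S}f(gs)$ and the Laplacian is $\mathcal{L}=I-A$. $\widehat{G}$ is the set of equivalence classes of irreducible complex representations of $G$; each class is represented by a unitary matrix representation $\sigma:G\to U(d_\sigma)$ with matrix entries $\sigma_{ij}$. The $\sigma$-isotypic Peter-Weyl block is $\mathcal{A}_\sigma:=\operatorname{span}\{\sigma_{ij}:1\le i,j\le d_\sigma\}\subseteq L^2(G)$; by Peter-Weyl, $L^2(G)$ is the orthogonal direct sum of the $\mathcal{A}_\sigma$. "Acts on $\mathcal{A}_\sigma$ as $I_{d_\sigma}\otimes B$" refers to the identification $\sigma_{ij}\leftrightarrow e_i\otimes e_j$ of $\mathcal{A}_\sigma$ with $\mathbb{C}^{d_\sigma}\otimes\mathbb{C}^{d_\sigma}$, i.e. $\sigma_{ij}\mapsto\sum_{k}\sigma_{ik}B_{kj}$.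 *)

theory Defs
  imports
    "HOL-Library.Function_Algebras"
    "HOL-Algebra.Generated_Groups"
    "Jordan_Normal_Form.Schur_Decomposition"
    "Jordan_Normal_Form.VS_Connect"
begin

definition cscale :: "complex \<Rightarrow> ('a \<Rightarrow> complex) \<Rightarrow> 'a \<Rightarrow> complex" where
  "cscale c f = (\<lambda>x. c * f x)"

interpretation cfun: vector_space "cscale :: complex \<Rightarrow> ('a \<Rightarrow> complex) \<Rightarrow> 'a \<Rightarrow> complex"
  by unfold_locales (auto simp: cscale_def algebra_simps)

text \<open>A function on the group is encoded as a function on the ambient type that vanishes
  outside the carrier; these functions form a linear subspace.\<close>

definition L2 :: "('a, 'b) monoid_scheme \<Rightarrow> ('a \<Rightarrow> complex) set" where
  "L2 G = {f. \<forall>x. x \<notin> carrier G \<longrightarrow> f x = 0}"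

definition symmetric_subset :: "('a, 'b) monoid_scheme \<Rightarrow> 'a set \<Rightarrow> bool" where
  "symmetric_subset G S \<longleftrightarrow> S \<subseteq> carrier G \<and> (\<forall>s\<in>S. inv\<^bsub>G\<^esub> s \<in> S)"

definition averaging :: "('a, 'b) monoid_scheme \<Rightarrow> 'a set \<Rightarrow> ('a \<Rightarrow> complex) \<Rightarrow> 'a \<Rightarrow> complex" where
  "averaging G S f = (\<lambda>g. if g \<in> carrier G
     then (\<Sum>s\<in>S. f (g \<otimes>\<^bsub>G\<^esub> s)) / of_nat (card S) else 0)"

definition laplacian :: "('a, 'b) monoid_scheme \<Rightarrow> 'a set \<Rightarrow> ('a \<Rightarrow> complex) \<Rightarrow> 'a \<Rightarrow> complex" where
  "laplacian G S f = f - averaging G S f"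

definition rep_dim :: "('a, 'b) monoid_scheme \<Rightarrow> ('a \<Rightarrow> complex mat) \<Rightarrow> nat" where
  "rep_dim G \<sigma> = dim_row (\<sigma> \<one>\<^bsub>G\<^esub>)"

definition matrix_rep :: "('a, 'b) monoid_scheme \<Rightarrow> ('a \<Rightarrow> complex mat) \<Rightarrow> bool" where
  "matrix_rep G \<sigma> \<longleftrightarrow>
     (\<forall>g\<in>carrier G. \<sigma> g \<in> carrier_mat (rep_dim G \<sigma>) (rep_dim G \<sigma>)) \<and>
     \<sigma> \<one>\<^bsub>G\<^esub> = 1\<^sub>m (rep_dim G \<sigma>) \<and>
     (\<forall>g\<in>carrier G. \<forall>h\<in>carrier G. \<sigma> (g \<otimes>\<^bsub>G\<^esub> h) = \<sigma> g * \<sigma> h)"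

definition irreducible_rep :: "('a, 'b) monoid_scheme \<Rightarrow> ('a \<Rightarrow> complex mat) \<Rightarrow> bool" where
  "irreducible_rep G \<sigma> \<longleftrightarrow> matrix_rep G \<sigma> \<and> rep_dim G \<sigma> > 0 \<and>
     (\<forall>W. VectorSpace.subspace class_ring W (module_vec TYPE(complex) (rep_dim G \<sigma>)) \<and>
          (\<forall>g\<in>carrier G. \<forall>w\<in>W. \<sigma> g *\<^sub>v w \<in> W)
        \<longrightarrow> W = {0\<^sub>v (rep_dim G \<sigma>)} \<or> W = carrier_vec (rep_dim G \<sigma>))"

definition unitary_rep :: "('a, 'b) monoid_scheme \<Rightarrow> ('a \<Rightarrow> complex mat) \<Rightarrow> bool" where
  "unitary_rep G \<sigma> \<longleftrightarrow> matrix_rep G \<sigma> \<and>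
     (\<forall>g\<in>carrier G. mat_adjoint (\<sigma> g) * \<sigma> g = 1\<^sub>m (rep_dim G \<sigma>))"

definition equivalent_reps ::
    "('a, 'b) monoid_scheme \<Rightarrow> ('a \<Rightarrow> complex mat) \<Rightarrow> ('a \<Rightarrow> complex mat) \<Rightarrow> bool" where
  "equivalent_reps G \<rho> \<sigma> \<longleftrightarrow> rep_dim G \<rho> = rep_dim G \<sigma> \<and>
     (\<exists>P \<in> carrier_mat (rep_dim G \<sigma>) (rep_dim G \<sigma>). invertible_mat P \<and>
        (\<forall>g\<in>carrier G. P * \<rho> g = \<sigma> g * P))"

text \<open>The dual of \<open>G\<close>, given by one unitary matrix representation from each equivalence class of
  irreducible representations.  The choice of representatives is left arbitrary.\<close>

definition unitary_dual :: "('a, 'b) monoid_scheme \<Rightarrow> ('a \<Rightarrow> complex mat) set \<Rightarrow> bool" where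
  "unitary_dual G D \<longleftrightarrow>
     (\<forall>\<sigma>\<in>D. irreducible_rep G \<sigma> \<and> unitary_rep G \<sigma>) \<and>
     (\<forall>\<rho>. irreducible_rep G \<rho> \<longrightarrow> (\<exists>!\<sigma>. \<sigma> \<in> D \<and> equivalent_reps G \<rho> \<sigma>))"

definition matrix_entry ::
    "('a, 'b) monoid_scheme \<Rightarrow> ('a \<Rightarrow> complex mat) \<Rightarrow> nat \<Rightarrow> nat \<Rightarrow> 'a \<Rightarrow> complex" where
  "matrix_entry G \<sigma> i j = (\<lambda>g. if g \<in> carrier G then \<sigma> g $$ (i, j) else 0)"

definition isotypic_block :: "('a, 'b) monoid_scheme \<Rightarrow> ('a \<Rightarrow> complex mat) \<Rightarrow> ('a \<Rightarrow> complex) set" where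
  "isotypic_block G \<sigma> =
     cfun.span {matrix_entry G \<sigma> i j | i j. i < rep_dim G \<sigma> \<and> j < rep_dim G \<sigma>}"

definition mean_matrix ::
    "('a, 'b) monoid_scheme \<Rightarrow> 'a set \<Rightarrow> ('a \<Rightarrow> complex mat) \<Rightarrow> complex mat" where
  "mean_matrix G S \<sigma> = mat (rep_dim G \<sigma>) (rep_dim G \<sigma>)
     (\<lambda>(i, j). (\<Sum>s\<in>S. \<sigma> s $$ (i, j)) / of_nat (card S))"

text \<open>The action of \<open>I \<otimes> B\<close> on the block, under \<open>\<sigma>\<^sub>i\<^sub>j \<leftrightarrow> e\<^sub>i \<otimes> e\<^sub>j\<close>: the linear extension to arbitrary
  coefficients \<open>c\<close> of \<open>\<sigma>\<^sub>i\<^sub>j \<mapsto> \<Sum>\<^sub>k \<sigma>\<^sub>i\<^sub>k B\<^sub>k\<^sub>j\<close>.\<close>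

definition acts_as_id_tensor ::
    "('a, 'b) monoid_scheme \<Rightarrow> ('a \<Rightarrow> complex mat) \<Rightarrow>
     (('a \<Rightarrow> complex) \<Rightarrow> 'a \<Rightarrow> complex) \<Rightarrow> complex mat \<Rightarrow> bool" where
  "acts_as_id_tensor G \<sigma> T B \<longleftrightarrow>
     (\<forall>c. T (\<Sum>i<rep_dim G \<sigma>. \<Sum>j<rep_dim G \<sigma>. cscale (c i j) (matrix_entry G \<sigma> i j)) =
        (\<Sum>i<rep_dim G \<sigma>. \<Sum>j<rep_dim G \<sigma>. cscale (c i j)
           (\<Sum>k<rep_dim G \<sigma>. cscale (B $$ (k, j)) (matrix_entry G \<sigma> i k))))"

end

theory Submission
  imports Defs
begin

text \<open>Since \<sigma>(gs) = \<sigma>(g)\<sigma>(s), right translation by s keeps the row index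
  of a matrix entry and mixes only the column index, through the matrix \<sigma>(s)
  (\<open>matrix_entry_mult\<close>). Averaging over S replaces \<sigma>(s) by
  \<open>mean_matrix\<close>, and subtracting from the identity gives the coefficients of I - M
  (\<open>laplacian_matrix_entry\<close>). Because the Laplacian is linear
  (\<open>linear_laplacian\<close>), this one formula on matrix entries yields both the invariance
  of their span and the tensor form of the action.\<close>

lemma sum_cscale_apply: "(\<Sum>i\<in>A. cscale (c i) (F i)) x = (\<Sum>i\<in>A. c i * F i x)"
  by (induction A rule: infinite_finite_induct) (auto simp: cscale_def)

lemma laplacian_in_L2: "f \<in> L2 G \<Longrightarrow> laplacian G S f \<in> L2 G"
  by (auto simp: L2_def laplacian_def averaging_def)

text \<open>This lets a formula on the matrix entries determine the operator on the whole
  block.\<close>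

lemma linear_laplacian: "Vector_Spaces.linear cscale cscale (laplacian G S)"
  by unfold_locales
    (auto simp: laplacian_def averaging_def cscale_def fun_eq_iff algebra_simps sum.distrib
      add_divide_distrib simp flip: sum_distrib_left)

lemma matrix_entry_mult:
  assumes "group G" "matrix_rep G \<sigma>" "g \<in> carrier G" "h \<in> carrier G"
    and "i < rep_dim G \<sigma>" "j < rep_dim G \<sigma>"
  shows "matrix_entry G \<sigma> i j (g \<otimes>\<^bsub>G\<^esub> h) = (\<Sum>k<rep_dim G \<sigma>. \<sigma> g $$ (i, k) * \<sigma> h $$ (k, j))"
proof -
  interpret group G by fact
  have "\<sigma> g \<in> carrier_mat (rep_dim G \<sigma>) (rep_dim G \<sigma>)" "\<sigma> h \<in> carrier_mat (rep_dim G \<sigma>) (rep_dim G \<sigma>)"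
    and "\<sigma> (g \<otimes>\<^bsub>G\<^esub> h) = \<sigma> g * \<sigma> h"
    using assms by (auto simp: matrix_rep_def)
  then show ?thesis
    using assms by (auto simp: matrix_entry_def scalar_prod_def atLeast0LessThan intro!: sum.cong)
qed

lemma laplacian_matrix_entry:
  assumes "group G" "S \<subseteq> carrier G" "matrix_rep G \<sigma>"
    and i: "i < rep_dim G \<sigma>" and j: "j < rep_dim G \<sigma>"
  shows "laplacian G S (matrix_entry G \<sigma> i j) =
    (\<Sum>k<rep_dim G \<sigma>. cscale ((1\<^sub>m (rep_dim G \<sigma>) - mean_matrix G S \<sigma>) $$ (k, j)) (matrix_entry G \<sigma> i k))"
proof
  fix g
  let ?d = "rep_dim G \<sigma>"
  show "laplacian G S (matrix_entry G \<sigma> i j) g =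
    (\<Sum>k<?d. cscale ((1\<^sub>m ?d - mean_matrix G S \<sigma>) $$ (k, j)) (matrix_entry G \<sigma> i k)) g"
  proof (cases "g \<in> carrier G")
    case False
    \<comment> \<open>Matrix entries and averages are 0 off the carrier by convention, so both sides
      vanish.\<close>
    then show ?thesis
      by (simp add: sum_cscale_apply laplacian_def averaging_def matrix_entry_def)
  next
    case g: True
    have "(\<Sum>s\<in>S. matrix_entry G \<sigma> i j (g \<otimes>\<^bsub>G\<^esub> s))
        = (\<Sum>s\<in>S. \<Sum>k<?d. \<sigma> g $$ (i, k) * \<sigma> s $$ (k, j))"
      using assms g by (intro sum.cong refl matrix_entry_mult) auto
    \<comment> \<open>The factor from g does not depend on s; the inner sum over S becomes an entry
      of \<open>mean_matrix\<close> once divided by \<open>card S\<close>.\<close>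
    also have "\<dots> = (\<Sum>k<?d. \<sigma> g $$ (i, k) * (\<Sum>s\<in>S. \<sigma> s $$ (k, j)))"
      by (subst sum.swap) (simp add: sum_distrib_left)
    finally have "averaging G S (matrix_entry G \<sigma> i j) g
        = (\<Sum>k<?d. \<sigma> g $$ (i, k) * mean_matrix G S \<sigma> $$ (k, j))"
      using g j by (simp add: averaging_def mean_matrix_def sum_divide_distrib[of _ "{..<?d}"]
        sum_divide_distrib[of _ S, symmetric])
    \<comment> \<open>The identity part of the Laplacian is written as a sum over k too, so that it
      merges with the average.\<close>
    moreover have "(\<Sum>k<?d. \<sigma> g $$ (i, k) * 1\<^sub>m ?d $$ (k, j)) = \<sigma> g $$ (i, j)"
      using j by (simp add: if_distrib cong: if_cong)
    moreover have "(1\<^sub>m ?d - mean_matrix G S \<sigma>) $$ (k, j)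
        = 1\<^sub>m ?d $$ (k, j) - mean_matrix G S \<sigma> $$ (k, j)" if "k < ?d" for k
      using that j by (simp add: mean_matrix_def)
    ultimately show ?thesis
      using g by (simp add: sum_cscale_apply laplacian_def matrix_entry_def right_diff_distrib
        sum_subtractf mult.commute)
  qed
qed

text \<open>Linearity moves the operator inside the double sum, and the two sides then agree term by
  term for any coefficients.\<close>

lemma laplacian_acts_as_id_tensor:
  assumes "group G" "S \<subseteq> carrier G" "matrix_rep G \<sigma>"
  shows "acts_as_id_tensor G \<sigma> (laplacian G S) (1\<^sub>m (rep_dim G \<sigma>) - mean_matrix G S \<sigma>)"
proof -
  interpret L: Vector_Spaces.linear cscale cscale "laplacian G S"
    by (rule linear_laplacian)
  show ?thesis
    unfolding acts_as_id_tensor_def L.sum L.scale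
    by (intro allI sum.cong refl arg_cong[where f = "cscale _"] laplacian_matrix_entry assms) auto
qed

lemma laplacian_isotypic_block:
  assumes "group G" "S \<subseteq> carrier G" "matrix_rep G \<sigma>"
  shows "laplacian G S ` isotypic_block G \<sigma> \<subseteq> isotypic_block G \<sigma>"
proof -
  interpret L: Vector_Spaces.linear cscale cscale "laplacian G S"
    by (rule linear_laplacian)
  let ?E = "{matrix_entry G \<sigma> i j | i j. i < rep_dim G \<sigma> \<and> j < rep_dim G \<sigma>}"
  have "matrix_entry G \<sigma> i j \<in> cfun.span ?E" if "i < rep_dim G \<sigma>" "j < rep_dim G \<sigma>" for i j
    using that by (intro cfun.span_base) blast
  then have "laplacian G S ` ?E \<subseteq> cfun.span ?E"
    by (auto simp: laplacian_matrix_entry[OF assms]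
      intro!: cfun.span_sum cfun.span_scale)
  \<comment> \<open>It suffices to treat the generators: a linear map sends the span of
    \<open>?E\<close> onto the span of the image of \<open>?E\<close>.\<close>
  then have "cfun.span (laplacian G S ` ?E) \<subseteq> cfun.span ?E"
    by (intro cfun.span_minimal cfun.subspace_span)
  then show ?thesis
    by (simp add: isotypic_block_def L.span_image)
qed

theorem proposition2:
  fixes G :: "('a, 'b) monoid_scheme" and S :: "'a set" and Ghat :: "('a \<Rightarrow> complex mat) set"
  assumes "group G" and "finite (carrier G)"
    and "symmetric_subset G S" and "S \<noteq> {}" and "generate G S = carrier G"
    and "unitary_dual G Ghat"
  shows "laplacian G S \<in> L2 G \<rightarrow> L2 G \<and>
    (\<forall>\<sigma>\<in>Ghat.
       laplacian G S ` isotypic_block G \<sigma> \<subseteq> isotypic_block G \<sigma> \<and>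
       acts_as_id_tensor G \<sigma> (laplacian G S) (1\<^sub>m (rep_dim G \<sigma>) - mean_matrix G S \<sigma>))"
proof -
  have "S \<subseteq> carrier G"
    using assms(3) by (simp add: symmetric_subset_def)
  moreover have "matrix_rep G \<sigma>" if "\<sigma> \<in> Ghat" for \<sigma>
    using assms(6) that by (simp add: unitary_dual_def unitary_rep_def)
  ultimately show ?thesis
    using assms(1) laplacian_in_L2 laplacian_isotypic_block laplacian_acts_as_id_tensor by blast
qed

end
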